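(* Let $\Omega$ be a finite set, let $G\le\mathrm{Sym}(\Omega)$ be an intransitive group, and let $p$ be a prime. Assume that every transitive constituent of $G$ is a cyclic $p$-group. If $\mathrm{Zel}(G)$ is trivial, then every orbit of $G$ is unessential.
   Context: For a finite set $\Omega$ and $H\le\mathrm{Sym}(\Omega)$, $\mathrm{Orb}(H)$ is the set of $H$-orbits on $\Omega$ and $\mathrm{Orb}_2(H)$ is the set of orbits of the induced (componentwise) action of $H$ on $\Omega\times\Omega$. The $2$-closure $\overline{H}$ is the largest subgroup of $\mathrm{Sym}(\Omega)$ with $\mathrm{Orb}_2(\overline{H})=\mathrm{Orb}_2(H)$; $H$ is $2$-closed if $H=\overline{H}$ (the same definition applies to permutation groups on any finite set). If $\Delta\subseteq\Omega$ is $H$-invariant, $H^\Delta\le\mathrm{Sym}(\Delta)$ is the permutation group induced by $H$ on $\Delta$; $H_{\Delta}$ denotes the pointwise stabilizer of $\Delta$ in $H$. The transitive constituents of $G$ are the groups $G^\Delta$, $\Delta\in\mathrm{Orb}(G)$. Intransitive means having at least two orbits. For orbits $\Delta,\Delta'$ of $G$ put $G_{\Delta'}^{\Delta}=(G_{\Delta'})^{\Delta}$. Define $$\mathrm{Zel}(G)=\prod_{\Delta\in\mathrm{Orb}(G)}\ \bigcap_{\Delta'\in\mathrm{Orb}(G),\ \Delta'\ne\Delta}G_{\Delta'}^{\Delta}\ \le\ \mathrm{Sym}(\Omega),$$ a direct product in which the factor indexed by $\Delta$ acts on $\Delta$ and fixes $\Omega\setminus\Delta$ pointwise. An orbit $\Delta$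 of $G$ is unessential if the following equivalence holds: $G$ is $2$-closed if and only if $G^{\Omega\setminus\Delta}$ is $2$-closed (as a permutation group on $\Omega\setminus\Delta$). *)

theory Defs
  imports "HOL-Algebra.Group_Action" "HOL-Algebra.Elementary_Groups"
    "HOL-Computational_Algebra.Primes"
begin

text \<open>
  \<open>Sym(\<Omega>)\<close> is \<^const>\<open>BijGroup\<close>: its elements are the bijections of \<open>\<Omega>\<close> that are
  extensional, that is, \<^const>\<open>undefined\<close> outside \<open>\<Omega>\<close>.  A permutation group on \<open>\<Omega>\<close> is a
  set \<open>H\<close> with \<^prop>\<open>subgroup H (BijGroup \<Omega>)\<close>.
\<close>

abbreviation perm_group :: "'a set \<Rightarrow> ('a \<Rightarrow> 'a) set \<Rightarrow> ('a \<Rightarrow> 'a) monoid" where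
  "perm_group \<Omega> H \<equiv> BijGroup \<Omega>\<lparr>carrier := H\<rparr>"

definition Orb :: "'a set \<Rightarrow> ('a \<Rightarrow> 'a) set \<Rightarrow> 'a set set" where
  "Orb \<Omega> H = orbits (perm_group \<Omega> H) \<Omega> (\<lambda>h. h)"

definition Orb2 :: "'a set \<Rightarrow> ('a \<Rightarrow> 'a) set \<Rightarrow> ('a \<times> 'a) set set" where
  "Orb2 \<Omega> H = orbits (perm_group \<Omega> H) (\<Omega> \<times> \<Omega>) (\<lambda>h. map_prod h h)"

text \<open>
  The greatest element with respect to inclusion; \<open>two_closure_greatest\<close> below shows that it
  exists.
\<close>

definition two_closure :: "'a set \<Rightarrow> ('a \<Rightarrow> 'a) set \<Rightarrow> ('a \<Rightarrow> 'a) set" where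
  "two_closure \<Omega> H = (GREATEST K. subgroup K (BijGroup \<Omega>) \<and> Orb2 \<Omega> K = Orb2 \<Omega> H)"

definition two_closed :: "'a set \<Rightarrow> ('a \<Rightarrow> 'a) set \<Rightarrow> bool" where
  "two_closed \<Omega> H \<longleftrightarrow> H = two_closure \<Omega> H"

text \<open>\<open>H\<^sup>\<Delta>\<close>, meaningful when \<open>\<Delta>\<close> is invariant under \<open>H\<close>.\<close>

definition induced :: "'a set \<Rightarrow> ('a \<Rightarrow> 'a) set \<Rightarrow> ('a \<Rightarrow> 'a) set" where
  "induced \<Delta> H = (\<lambda>h. restrict h \<Delta>) ` H"

definition pointwise_stabilizer :: "'a set \<Rightarrow> ('a \<Rightarrow> 'a) set \<Rightarrow> ('a \<Rightarrow> 'a) set" where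
  "pointwise_stabilizer \<Delta> H = {h \<in> H. \<forall>x\<in>\<Delta>. h x = x}"

text \<open>
  The direct product of groups acting on the orbits \<open>\<Delta>\<close>, each fixing the rest of \<open>\<Omega>\<close> pointwise,
  consists of the permutations of \<open>\<Omega>\<close> whose restriction to every \<open>\<Delta>\<close> lies in the factor
  indexed by \<open>\<Delta>\<close>.  For transitive \<open>G\<close> the intersection over no orbits is \<^const>\<open>UNIV\<close>, and
  \<open>Zel \<Omega> G\<close> is all of \<open>Sym(\<Omega>)\<close>.
\<close>

definition Zel :: "'a set \<Rightarrow> ('a \<Rightarrow> 'a) set \<Rightarrow> ('a \<Rightarrow> 'a) set" where
  "Zel \<Omega> G = {g \<in> carrier (BijGroup \<Omega>). \<forall>\<Delta>\<in>Orb \<Omega> G.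
     restrict g \<Delta> \<in> (\<Inter>\<Delta>'\<in>Orb \<Omega> G - {\<Delta>}. induced \<Delta> (pointwise_stabilizer \<Delta>' G))}"

definition unessential :: "'a set \<Rightarrow> ('a \<Rightarrow> 'a) set \<Rightarrow> 'a set \<Rightarrow> bool" where
  "unessential \<Omega> G \<Delta> \<longleftrightarrow>
     (two_closed \<Omega> G \<longleftrightarrow> two_closed (\<Omega> - \<Delta>) (induced (\<Omega> - \<Delta>) G))"

definition intransitive :: "'a set \<Rightarrow> ('a \<Rightarrow> 'a) set \<Rightarrow> bool" where
  "intransitive \<Omega> G \<longleftrightarrow> 2 \<le> card (Orb \<Omega> G)"

text \<open>Finite \<open>p\<close>-groups; the trivial group is one.\<close>

definition finite_p_group :: "nat \<Rightarrow> ('a, 'b) monoid_scheme \<Rightarrow> bool" where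
  "finite_p_group p H \<longleftrightarrow> group H \<and> (\<exists>k. order H = p ^ k)"

lemma BijGroup_simps:
  "carrier (BijGroup \<Omega>) = Bij \<Omega>"
  "\<one>\<^bsub>BijGroup \<Omega>\<^esub> = (\<lambda>x\<in>\<Omega>. x)"
  "f \<in> Bij \<Omega> \<Longrightarrow> g \<in> Bij \<Omega> \<Longrightarrow> f \<otimes>\<^bsub>BijGroup \<Omega>\<^esub> g = compose \<Omega> f g"
  by (simp_all add: BijGroup_def)

lemma Bij_mem: "f \<in> Bij \<Omega> \<Longrightarrow> x \<in> \<Omega> \<Longrightarrow> f x \<in> \<Omega>"
  by (auto simp: Bij_def bij_betw_def)

lemma Orb2_eq: "Orb2 \<Omega> H = {{(h x, h y) | h. h \<in> H} | x y. x \<in> \<Omega> \<and> y \<in> \<Omega>}"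
  by (auto simp: Orb2_def orbits_def orbit_def; force)

lemma two_closure_greatest:
  fixes \<Omega> :: "'a set"
  assumes H: "subgroup H (BijGroup \<Omega>)"
  defines "K \<equiv> {f \<in> Bij \<Omega>. \<forall>x\<in>\<Omega>. \<forall>y\<in>\<Omega>. \<exists>h\<in>H. f x = h x \<and> f y = h y}"
  shows "subgroup K (BijGroup \<Omega>)"
    and "Orb2 \<Omega> K = Orb2 \<Omega> H"
    and "subgroup L (BijGroup \<Omega>) \<Longrightarrow> Orb2 \<Omega> L = Orb2 \<Omega> H \<Longrightarrow> L \<subseteq> K"
    and "two_closure \<Omega> H = K"
proof -
  interpret B: group "BijGroup \<Omega>" by (rule group_BijGroup)
  interpret H: subgroup H "BijGroup \<Omega>" by fact
  have HB: "H \<subseteq> Bij \<Omega>" using H.subset by (simp add: BijGroup_simps)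
  have one_in: "(\<lambda>x\<in>\<Omega>. x) \<in> L" if "subgroup L (BijGroup \<Omega>)" for L
    using subgroup.one_closed[OF that] by (simp add: BijGroup_simps)
  have inv_app: "(inv\<^bsub>BijGroup \<Omega>\<^esub> f) (f x) = x" if "f \<in> Bij \<Omega>" "x \<in> \<Omega>" for f x
  proof -
    have "inv\<^bsub>BijGroup \<Omega>\<^esub> f \<otimes>\<^bsub>BijGroup \<Omega>\<^esub> f = \<one>\<^bsub>BijGroup \<Omega>\<^esub>"
      using that by (simp add: BijGroup_simps)
    moreover have "inv\<^bsub>BijGroup \<Omega>\<^esub> f \<in> Bij \<Omega>"
      using that B.inv_closed[of f] by (simp add: BijGroup_simps)
    ultimately have "compose \<Omega> (inv\<^bsub>BijGroup \<Omega>\<^esub> f) f = (\<lambda>x\<in>\<Omega>. x)"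
      using that by (simp add: BijGroup_simps)
    then show ?thesis using that by (metis compose_eq restrict_apply')
  qed
  show K: "subgroup K (BijGroup \<Omega>)"
  proof (rule B.subgroupI)
    show "K \<subseteq> carrier (BijGroup \<Omega>)" by (auto simp: K_def BijGroup_simps)
    show "K \<noteq> {}" using HB one_in[OF H] by (auto simp: K_def)
  next
    fix f assume f: "f \<in> K"
    then have fB: "f \<in> Bij \<Omega>" by (simp add: K_def)
    let ?g = "inv\<^bsub>BijGroup \<Omega>\<^esub> f"
    have gB: "?g \<in> Bij \<Omega>" using fB B.inv_closed[of f] by (simp add: BijGroup_simps)
    have "\<exists>h\<in>H. ?g x = h x \<and> ?g y = h y" if xy: "x \<in> \<Omega>" "y \<in> \<Omega>" for x y
    proof -
      obtain a b where ab: "a \<in> \<Omega>" "b \<in> \<Omega>" "x = f a" "y = f b"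
        using fB xy unfolding Bij_def bij_betw_def by blast
      obtain h where h: "h \<in> H" "f a = h a" "f b = h b" using f ab by (auto simp: K_def)
      have "inv\<^bsub>BijGroup \<Omega>\<^esub> h \<in> H" using h by simp
      moreover have "?g x = (inv\<^bsub>BijGroup \<Omega>\<^esub> h) x" "?g y = (inv\<^bsub>BijGroup \<Omega>\<^esub> h) y"
        using inv_app ab h fB HB by (metis subsetD)+
      ultimately show ?thesis by blast
    qed
    with gB show "?g \<in> K" by (simp add: K_def)
  next
    fix f g assume f: "f \<in> K" and g: "g \<in> K"
    then have fB: "f \<in> Bij \<Omega>" and gB: "g \<in> Bij \<Omega>" by (simp_all add: K_def)
    have "\<exists>h\<in>H. compose \<Omega> f g x = h x \<and> compose \<Omega> f g y = h y" if xy: "x \<in> \<Omega>" "y \<in> \<Omega>" for x y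
    proof -
      obtain h where h: "h \<in> H" "g x = h x" "g y = h y" using g xy by (auto simp: K_def)
      obtain k where k: "k \<in> H" "f (g x) = k (g x)" "f (g y) = k (g y)"
        using f Bij_mem[OF gB] xy unfolding K_def by blast
      have "compose \<Omega> k h \<in> H"
        using H.m_closed[OF k(1) h(1)] subsetD[OF HB h(1)] subsetD[OF HB k(1)]
        by (simp only: BijGroup_simps)
      then show ?thesis
        using h(2,3) k(2,3) by (intro bexI[of _ "compose \<Omega> k h"]) (simp_all only: compose_eq[OF xy(1)] compose_eq[OF xy(2)])
    qed
    then show "f \<otimes>\<^bsub>BijGroup \<Omega>\<^esub> g \<in> K"
      using fB gB by (simp add: BijGroup_simps K_def compose_Bij)
  qed
  have HK: "H \<subseteq> K" using HB by (auto simp: K_def)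
  have *: "{(h x, h y) | h. h \<in> K} = {(h x, h y) | h. h \<in> H}" if "x \<in> \<Omega>" "y \<in> \<Omega>" for x y
  proof
    show "{(h x, h y) | h. h \<in> K} \<subseteq> {(h x, h y) | h. h \<in> H}"
    proof
      fix z assume "z \<in> {(h x, h y) | h. h \<in> K}"
      then obtain f where f: "f \<in> K" "z = (f x, f y)" by blast
      have "\<forall>x\<in>\<Omega>. \<forall>y\<in>\<Omega>. \<exists>h\<in>H. f x = h x \<and> f y = h y"
        using f(1) by (simp add: K_def)
      then obtain h where "h \<in> H" "f x = h x" "f y = h y"
        using \<open>x \<in> \<Omega>\<close> \<open>y \<in> \<Omega>\<close> by meson
      with f(2) show "z \<in> {(h x, h y) | h. h \<in> H}" by auto
    qed
  qed (use HK in blast)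
  have "(z = {(h x, h y) | h. h \<in> K} \<and> x \<in> \<Omega> \<and> y \<in> \<Omega>) \<longleftrightarrow>
        (z = {(h x, h y) | h. h \<in> H} \<and> x \<in> \<Omega> \<and> y \<in> \<Omega>)" for x y z
    using *[of x y] by (cases "x \<in> \<Omega> \<and> y \<in> \<Omega>") (simp, blast)
  then show O: "Orb2 \<Omega> K = Orb2 \<Omega> H"
    unfolding Orb2_eq by (simp only:)
  show max: "L \<subseteq> K" if L: "subgroup L (BijGroup \<Omega>)" and LO: "Orb2 \<Omega> L = Orb2 \<Omega> H" for L
  proof
    fix f assume f: "f \<in> L"
    have fB: "f \<in> Bij \<Omega>" using subgroup.subset[OF L] f by (auto simp: BijGroup_simps)
    have "\<exists>h\<in>H. f x = h x \<and> f y = h y" if xy: "x \<in> \<Omega>" "y \<in> \<Omega>" for x y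
    proof -
      have "{(h x, h y) | h. h \<in> L} \<in> Orb2 \<Omega> L" unfolding Orb2_eq using xy by auto
      then have "{(h x, h y) | h. h \<in> L} \<in> Orb2 \<Omega> H" by (simp only: LO)
      then obtain a b where ab: "a \<in> \<Omega>" "b \<in> \<Omega>"
        and eq: "{(h x, h y) | h. h \<in> L} = {(h a, h b) | h. h \<in> H}"
        unfolding Orb2_eq by (elim CollectE exE conjE)
      have "(x, y) \<in> {(h x, h y) | h. h \<in> L}" 
        by (rule CollectI, rule exI[of _ "\<lambda>x\<in>\<Omega>. x"]) (use one_in[OF L] xy in simp)
      then obtain k where k: "k \<in> H" "x = k a" "y = k b" unfolding eq by blast
      have "(f x, f y) \<in> {(h x, h y) | h. h \<in> L}" using f by blast
      then obtain h where h: "h \<in> H" "f x = h a" "f y = h b" unfolding eq by blast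
      let ?j = "inv\<^bsub>BijGroup \<Omega>\<^esub> k"
      have j: "?j \<in> H" using k(1) by (rule H.m_inv_closed)
      have jxy: "?j x = a" "?j y = b"
        unfolding k(2,3) using inv_app[of k] k(1) ab HB by blast+
      have "compose \<Omega> h ?j \<in> H"
        using H.m_closed[OF h(1) j] subsetD[OF HB h(1)] subsetD[OF HB j] by (simp only: BijGroup_simps)
      then show ?thesis
        using h(2,3) jxy by (intro bexI[of _ "compose \<Omega> h ?j"]) (simp_all only: compose_eq[OF xy(1)] compose_eq[OF xy(2)])
    qed
    then show "f \<in> K" using fB by (simp add: K_def)
  qed
  show "two_closure \<Omega> H = K"
    unfolding two_closure_def by (rule Greatest_equality) (use K O max in auto)
qed

end

theory Submission
  imports Defs "HOL-Algebra.Multiplicative_Group"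
begin

text \<open>
  An abelian group acts regularly on each of its orbits, so a permutation lies in the 2-closure of
  \<open>G\<close> iff on the union of any two orbits it agrees with an element of \<open>G\<close>.  The nontrivial
  subgroups of a cyclic \<open>p\<close>-group share a nontrivial element; hence if \<open>Zel(G)\<close> is trivial, then
  for every orbit \<open>\<Delta>\<close> there is another orbit \<open>\<Delta>'\<close> whose pointwise stabilizer fixes \<open>\<Delta>\<close>
  pointwise.  So the action of an element of \<open>G\<close> on \<open>\<Delta>'\<close> determines its action on \<open>\<Delta>\<close>, and
  permutations in the 2-closure of \<open>G\<close> correspond to those in the 2-closure of the group induced
  on the complement of \<open>\<Delta>\<close>.
\<close>

section \<open>Cyclic \<open>p\<close>-groups\<close>

text \<open>For a generator \<open>a\<close> of order \<open>p ^ k\<close> with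
  \<open>k = Suc j\<close>, the witness is \<open>a\<close> to the power \<open>p ^ j\<close>, an
  element of order \<open>p\<close>. A nontrivial subgroup contains a power of \<open>a\<close>
  whose exponent \<open>m\<close> is not divisible by \<open>p ^ k\<close>. Then the gcd of
  \<open>m\<close> and \<open>p ^ k\<close> is a proper divisor of \<open>p ^ k\<close>, so it
  divides \<open>p ^ j\<close>, and Bezout makes the witness a power of that element.\<close>

lemma (in group) cyclic_p_group_minimal_subgroup:
  assumes "cyclic_group G" and "finite_p_group p G" and p: "prime p" and "carrier G \<noteq> {\<one>}"
  obtains z where "z \<in> carrier G" "z \<noteq> \<one>"
    "\<And>H. subgroup H G \<Longrightarrow> H \<noteq> {\<one>} \<Longrightarrow> z \<in> H"
proof -
  obtain a where a: "a \<in> carrier G" and gen: "carrier G = range (\<lambda>n::int. a [^] n)"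
    using assms(1) cyclic_group by auto
  obtain k where k: "order G = p ^ k" using assms(2) by (auto simp: finite_p_group_def)
  have fin: "finite (carrier G)"
    using k p by (intro card_ge_0_finite) (simp add: order_def prime_gt_0_nat)
  have "generate G {a} = carrier G" using generate_pow[OF a] gen by auto
  then have ord: "ord a = p ^ k" using generate_pow_card[OF a] k by (simp add: order_def)
  have "k \<noteq> 0"
  proof
    assume "k = 0"
    then have "card (carrier G) = 1" using k by (simp add: order_def)
    then show False using \<open>carrier G \<noteq> {\<one>}\<close> one_closed by (metis card_1_singletonE singletonD)
  qed
  then obtain j where j: "k = Suc j" by (cases k) auto
  define z where "z = a [^] int (p ^ j)"
  show ?thesis
  proof
    show "z \<in> carrier G" using a by (simp add: z_def)
    show "z \<noteq> \<one>"
    proof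
      assume "z = \<one>"
      then have "p ^ k dvd p ^ j"
        using int_pow_eq_id[OF a] ord int_dvd_int_iff by (metis z_def)
      then show False using p j by (simp add: dvd_power_iff_le prime_ge_2_nat)
    qed
    fix H assume H: "subgroup H G" "H \<noteq> {\<one>}"
    then obtain x where x: "x \<in> H" "x \<noteq> \<one>" using subgroup.one_closed by blast
    then obtain m :: int where m: "x = a [^] m" using gen subgroup.subset[OF H(1)] by blast
    have ndvd: "\<not> int (p ^ k) dvd m" using x(2) m int_pow_eq_id[OF a] ord by metis
    have "gcd m (int (p ^ k)) dvd int (p ^ k)" by simp
    then have "nat (gcd m (int (p ^ k))) dvd p ^ k"
      by (metis gcd_ge_0_int int_dvd_int_iff int_nat_eq)
    then obtain i where i: "i \<le> k" "nat (gcd m (int (p ^ k))) = p ^ i"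
      using divides_primepow_nat[OF p] by blast
    then have gi: "gcd m (int (p ^ k)) = int (p ^ i)" by (metis gcd_ge_0_int int_nat_eq)
    have "i \<noteq> k" using ndvd gi by (metis gcd_dvd1)
    then have "p ^ i dvd p ^ j" using i j by (simp add: le_imp_power_dvd)
    then have "gcd m (int (p ^ k)) dvd int (p ^ j)" by (simp only: gi int_dvd_int_iff)
    then obtain c where c: "int (p ^ j) = gcd m (int (p ^ k)) * c" by (elim dvdE)
    obtain u v where uv: "u * m + v * int (p ^ k) = gcd m (int (p ^ k))" using bezout_int by blast
    \<comment> \<open>The Bezout identity is scaled by \<open>c\<close> to reach the exponent of
      \<open>z\<close>; the summand containing \<open>p ^ k\<close> contributes only \<one>, since
      \<open>a\<close> has order \<open>p ^ k\<close>.\<close>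
    have "int (p ^ j) = (u * m + v * int (p ^ k)) * c" using c by (simp only: uv)
    also have "\<dots> = m * (u * c) + int (p ^ k) * (v * c)" by (simp add: algebra_simps)
    finally have "z = (a [^] m) [^] (u * c) \<otimes> (a [^] int (p ^ k)) [^] (v * c)"
      unfolding z_def using a by (simp only: int_pow_mult int_pow_pow)
    moreover have "a [^] int (p ^ k) = \<one>" using int_pow_eq_id[OF a] ord by simp
    ultimately have "z = x [^] (u * c)"
      using m a by (metis int_pow_closed int_pow_one r_one)
    then show "z \<in> H"
      using x H(1) subgroup_int_pow_closed by metis
  qed
qed

section \<open>Permutation groups: orbits, restrictions and 2-closedness\<close>

text \<open>Used to extend a permutation of the complement of an orbit by an element of
  \<open>G\<close>, and to extend a permutation of one orbit by the identity.\<close>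

lemma glue_in_Bij:
  assumes sub: "\<Delta> \<subseteq> \<Omega>" and f: "bij_betw f \<Delta> \<Delta>" and g: "bij_betw g (\<Omega> - \<Delta>) (\<Omega> - \<Delta>)"
  shows "(\<lambda>x\<in>\<Omega>. if x \<in> \<Delta> then f x else g x) \<in> Bij \<Omega>" (is "?F \<in> _")
proof -
  have eq: "?F x = f x" if "x \<in> \<Delta>" for x using that sub by auto
  have "bij_betw ?F \<Delta> \<Delta>" using iffD2[OF bij_betw_cong[OF eq] f] .
  moreover have eq': "?F x = g x" if "x \<in> \<Omega> - \<Delta>" for x using that by simp
  have "bij_betw ?F (\<Omega> - \<Delta>) (\<Omega> - \<Delta>)" using iffD2[OF bij_betw_cong[OF eq'] g] .
  ultimately have "bij_betw ?F (\<Delta> \<union> (\<Omega> - \<Delta>)) (\<Delta> \<union> (\<Omega> - \<Delta>))"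
    by (rule bij_betw_combine) auto
  moreover have "\<Delta> \<union> (\<Omega> - \<Delta>) = \<Omega>" using sub by auto
  ultimately show ?thesis by (simp add: Bij_def)
qed

locale permutation_group =
  fixes \<Omega> :: "'a set" and G :: "('a \<Rightarrow> 'a) set"
  assumes subgroup_Sym: "subgroup G (BijGroup \<Omega>)"
begin

lemma in_Bij: "g \<in> G \<Longrightarrow> g \<in> Bij \<Omega>"
  using subgroup.subset[OF subgroup_Sym] by (auto simp: BijGroup_simps)

lemma in_range: "g \<in> G \<Longrightarrow> x \<in> \<Omega> \<Longrightarrow> g x \<in> \<Omega>"
  by (rule Bij_mem[OF in_Bij])

lemma compose_closed: "g \<in> G \<Longrightarrow> h \<in> G \<Longrightarrow> compose \<Omega> g h \<in> G"
  using subgroup.m_closed[OF subgroup_Sym] in_Bij by (metis BijGroup_simps(3))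

lemma id_closed: "(\<lambda>x\<in>\<Omega>. x) \<in> G"
  using subgroup.one_closed[OF subgroup_Sym] by (simp add: BijGroup_simps)

lemma inverse_closed:
  assumes g: "g \<in> G"
  obtains g' where "g' \<in> G" "\<And>x. x \<in> \<Omega> \<Longrightarrow> g' (g x) = x" "\<And>x. x \<in> \<Omega> \<Longrightarrow> g (g' x) = x"
proof
  show inv: "inv\<^bsub>BijGroup \<Omega>\<^esub> g \<in> G" using subgroup.m_inv_closed[OF subgroup_Sym g] .
  have "inv\<^bsub>BijGroup \<Omega>\<^esub> g \<otimes>\<^bsub>BijGroup \<Omega>\<^esub> g = \<one>\<^bsub>BijGroup \<Omega>\<^esub>"
    "g \<otimes>\<^bsub>BijGroup \<Omega>\<^esub> inv\<^bsub>BijGroup \<Omega>\<^esub> g = \<one>\<^bsub>BijGroup \<Omega>\<^esub>"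
    using group.l_inv[OF group_BijGroup] group.r_inv[OF group_BijGroup] in_Bij[OF g]
    by (simp_all add: BijGroup_simps)
  then have "compose \<Omega> (inv\<^bsub>BijGroup \<Omega>\<^esub> g) g = (\<lambda>x\<in>\<Omega>. x)"
    "compose \<Omega> g (inv\<^bsub>BijGroup \<Omega>\<^esub> g) = (\<lambda>x\<in>\<Omega>. x)"
    using in_Bij[OF g] in_Bij[OF inv] by (simp_all add: BijGroup_simps)
  then show "(inv\<^bsub>BijGroup \<Omega>\<^esub> g) (g x) = x" "g ((inv\<^bsub>BijGroup \<Omega>\<^esub> g) x) = x" if "x \<in> \<Omega>" for x
    using that by (metis compose_eq restrict_apply')+
qed

lemma Orb_eq: "Orb \<Omega> G = {{g x | g. g \<in> G} | x. x \<in> \<Omega>}"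
  by (auto simp: Orb_def orbits_def orbit_def)

lemma orbit_of_mem:
  assumes "\<Delta> \<in> Orb \<Omega> G" "x \<in> \<Delta>"
  shows "\<Delta> = {g x | g. g \<in> G}"
proof -
  obtain a where a: "a \<in> \<Omega>" "\<Delta> = {g a | g. g \<in> G}" using assms(1) Orb_eq by auto
  then obtain h where h: "h \<in> G" "x = h a" using assms(2) by auto
  obtain h' where h': "h' \<in> G" "\<And>x. x \<in> \<Omega> \<Longrightarrow> h' (h x) = x" using inverse_closed[OF h(1)] by metis
  have "g a \<in> {g x | g. g \<in> G}" if "g \<in> G" for g
    using that h' h a in_range compose_closed[OF that h'(1)]
    by (intro CollectI exI[of _ "compose \<Omega> g h'"]) (simp add: compose_eq)
  moreover have "g x \<in> {g a | g. g \<in> G}" if "g \<in> G" for g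
    using h a compose_closed[OF that h(1)]
    by (intro CollectI exI[of _ "compose \<Omega> g h"]) (simp add: compose_eq)
  ultimately show ?thesis using a(2) by auto
qed

lemma orbit_exists:
  assumes "x \<in> \<Omega>"
  obtains \<Delta> where "\<Delta> \<in> Orb \<Omega> G" "x \<in> \<Delta>"
proof
  show "{g x | g. g \<in> G} \<in> Orb \<Omega> G" using assms by (auto simp: Orb_eq)
  show "x \<in> {g x | g. g \<in> G}"
    using id_closed assms by (intro CollectI exI[of _ "\<lambda>x\<in>\<Omega>. x"]) simp
qed

lemma orbit_subset:
  assumes "\<Delta> \<in> Orb \<Omega> G"
  shows "\<Delta> \<subseteq> \<Omega>"
proof -
  obtain x where "x \<in> \<Omega>" "\<Delta> = {g x | g. g \<in> G}" using assms unfolding Orb_eq by blast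
  then show ?thesis using in_range by blast
qed

lemma orbit_nonempty:
  assumes "\<Delta> \<in> Orb \<Omega> G"
  shows "\<Delta> \<noteq> {}"
proof -
  obtain x where "\<Delta> = {g x | g. g \<in> G}" using assms unfolding Orb_eq by blast
  then show ?thesis using id_closed by blast
qed

lemma orbit_disjoint:
  assumes "\<Delta> \<in> Orb \<Omega> G" "\<Delta>' \<in> Orb \<Omega> G" "\<Delta> \<noteq> \<Delta>'"
  shows "\<Delta> \<inter> \<Delta>' = {}"
proof (rule ccontr)
  assume "\<Delta> \<inter> \<Delta>' \<noteq> {}"
  then obtain x where "x \<in> \<Delta>" "x \<in> \<Delta>'" by blast
  then have "\<Delta> = \<Delta>'" using trans[OF orbit_of_mem orbit_of_mem[symmetric]] assms(1,2) by blast
  then show False using assms(3) by contradiction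
qed

lemma orbit_mem:
  assumes "\<Delta> \<in> Orb \<Omega> G" "x \<in> \<Delta>" "g \<in> G"
  shows "g x \<in> \<Delta>"
proof -
  have "g x \<in> {g x | g. g \<in> G}" using assms(3) by blast
  then show ?thesis unfolding orbit_of_mem[OF assms(1,2), symmetric] .
qed

lemma orbit_image_subset: "\<Delta> \<in> Orb \<Omega> G \<Longrightarrow> \<forall>g\<in>G. g ` \<Delta> \<subseteq> \<Delta>"
  using orbit_mem by blast

lemma orbit_mem_iff:
  assumes "\<Delta> \<in> Orb \<Omega> G" "x \<in> \<Omega>" "g \<in> G"
  shows "g x \<in> \<Delta> \<longleftrightarrow> x \<in> \<Delta>"
proof -
  obtain g' where "g' \<in> G" "g' (g x) = x" using inverse_closed[OF assms(3)] assms(2) by metis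
  then show ?thesis using orbit_mem[OF assms(1)] assms(3) by metis
qed

text \<open>Invariance is assumed for all of \<open>G\<close>, so the inverse of \<open>g\<close>
  also maps \<Delta> into itself and witnesses bijectivity.\<close>

lemma bij_betw_invariant:
  assumes g: "g \<in> G" and "\<Delta> \<subseteq> \<Omega>" and inv: "\<forall>h\<in>G. h ` \<Delta> \<subseteq> \<Delta>"
  shows "bij_betw g \<Delta> \<Delta>"
proof -
  obtain g' where g': "g' \<in> G" "\<And>x. x \<in> \<Omega> \<Longrightarrow> g' (g x) = x" "\<And>x. x \<in> \<Omega> \<Longrightarrow> g (g' x) = x"
    using inverse_closed[OF g] by metis
  then have "\<forall>x\<in>\<Delta>. g' (g x) = x" "\<forall>x\<in>\<Delta>. g (g' x) = x" using assms(2) by auto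
  then show ?thesis using inv g g'(1) by (intro bij_betw_byWitness[where f' = g']) auto
qed

lemma restrict_in_Bij:
  assumes "g \<in> G" "\<Delta> \<subseteq> \<Omega>" "\<forall>h\<in>G. h ` \<Delta> \<subseteq> \<Delta>"
  shows "restrict g \<Delta> \<in> Bij \<Delta>"
  using bij_betw_invariant[OF assms] by (simp add: Bij_def)

lemma induced_subgroup:
  assumes sub: "\<Delta> \<subseteq> \<Omega>" and inv: "\<forall>h\<in>G. h ` \<Delta> \<subseteq> \<Delta>"
  shows "subgroup (induced \<Delta> G) (BijGroup \<Delta>)"
proof -
  interpret B: group "BijGroup \<Delta>" by (rule group_BijGroup)
  have rB: "restrict g \<Delta> \<in> Bij \<Delta>" if "g \<in> G" for g using restrict_in_Bij[OF that sub inv] .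
  \<comment> \<open>Restriction to an invariant set is multiplicative; closure under products and
    inverses is pulled back to \<open>G\<close> through this.\<close>
  have mult: "restrict g \<Delta> \<otimes>\<^bsub>BijGroup \<Delta>\<^esub> restrict h \<Delta> = restrict (compose \<Omega> g h) \<Delta>"
    if "g \<in> G" "h \<in> G" for g h
    using that rB[OF that(1)] rB[OF that(2)] sub inv
    by (auto simp: BijGroup_simps compose_def fun_eq_iff image_subset_iff)
  show ?thesis
  proof (rule B.subgroupI)
    show "induced \<Delta> G \<subseteq> carrier (BijGroup \<Delta>)" using rB by (auto simp: induced_def BijGroup_simps)
    show "induced \<Delta> G \<noteq> {}" using id_closed by (auto simp: induced_def)
  next
    fix a b assume "a \<in> induced \<Delta> G" "b \<in> induced \<Delta> G"
    then show "a \<otimes>\<^bsub>BijGroup \<Delta>\<^esub> b \<in> induced \<Delta> G"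
      using mult compose_closed by (force simp: induced_def)
  next
    fix a assume "a \<in> induced \<Delta> G"
    then obtain g where g: "g \<in> G" "a = restrict g \<Delta>" by (auto simp: induced_def)
    obtain g' where g': "g' \<in> G" "\<And>x. x \<in> \<Omega> \<Longrightarrow> g' (g x) = x" using inverse_closed[OF g(1)] by metis
    have "restrict g' \<Delta> \<otimes>\<^bsub>BijGroup \<Delta>\<^esub> a = \<one>\<^bsub>BijGroup \<Delta>\<^esub>"
      unfolding g(2) mult[OF g'(1) g(1)] using g'(2) sub
      by (auto simp: BijGroup_simps compose_def fun_eq_iff)
    then have "inv\<^bsub>BijGroup \<Delta>\<^esub> a = restrict g' \<Delta>"
      using rB g g' by (intro B.inv_equality) (auto simp: BijGroup_simps)
    then show "inv\<^bsub>BijGroup \<Delta>\<^esub> a \<in> induced \<Delta> G" using g' by (auto simp: induced_def)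
  qed
qed

text \<open>Makes the stabilizer a permutation group on \<Omega> itself, so that
  \<open>induced_subgroup\<close> applies to it as well.\<close>

lemma pointwise_stabilizer_subgroup:
  assumes sub: "\<Delta> \<subseteq> \<Omega>"
  shows "subgroup (pointwise_stabilizer \<Delta> G) (BijGroup \<Omega>)"
proof (rule group.subgroupI[OF group_BijGroup])
  show "pointwise_stabilizer \<Delta> G \<subseteq> carrier (BijGroup \<Omega>)"
    using in_Bij by (auto simp: pointwise_stabilizer_def BijGroup_simps)
  show "pointwise_stabilizer \<Delta> G \<noteq> {}"
    using id_closed sub by (auto simp: pointwise_stabilizer_def intro!: exI[of _ "\<lambda>x\<in>\<Omega>. x"])
next
  fix g h assume "g \<in> pointwise_stabilizer \<Delta> G" "h \<in> pointwise_stabilizer \<Delta> G"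
  then show "g \<otimes>\<^bsub>BijGroup \<Omega>\<^esub> h \<in> pointwise_stabilizer \<Delta> G"
    using sub in_Bij compose_closed
    by (auto simp: pointwise_stabilizer_def BijGroup_simps compose_def subset_iff)
next
  fix g assume "g \<in> pointwise_stabilizer \<Delta> G"
  then have g: "g \<in> G" "\<And>x. x \<in> \<Delta> \<Longrightarrow> g x = x" by (auto simp: pointwise_stabilizer_def)
  obtain g' where g': "g' \<in> G" "\<And>x. x \<in> \<Omega> \<Longrightarrow> g' (g x) = x" using inverse_closed[OF g(1)] by metis
  have "compose \<Omega> g' g = (\<lambda>x\<in>\<Omega>. x)" using g' by (auto simp: compose_def)
  then have "inv\<^bsub>BijGroup \<Omega>\<^esub> g = g'"
    using in_Bij[OF g(1)] in_Bij[OF g'(1)]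
    by (intro group.inv_equality[OF group_BijGroup]) (auto simp: BijGroup_simps)
  moreover have "g' x = x" if "x \<in> \<Delta>" for x using that g(2) g'(2) sub by (metis subsetD)
  ultimately show "inv\<^bsub>BijGroup \<Omega>\<^esub> g \<in> pointwise_stabilizer \<Delta> G"
    using g' by (simp add: pointwise_stabilizer_def)
qed

text \<open>\<open>G\<close> always lies in its 2-closure, so only the reverse inclusion has
  content.\<close>

lemma two_closed_iff:
  "two_closed \<Omega> G \<longleftrightarrow>
     (\<forall>f\<in>Bij \<Omega>. (\<forall>x\<in>\<Omega>. \<forall>y\<in>\<Omega>. \<exists>h\<in>G. f x = h x \<and> f y = h y) \<longrightarrow> f \<in> G)"
proof -
  let ?K = "{f \<in> Bij \<Omega>. \<forall>x\<in>\<Omega>. \<forall>y\<in>\<Omega>. \<exists>h\<in>G. f x = h x \<and> f y = h y}"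
  have "G \<subseteq> ?K" using in_Bij by auto
  then have "G = ?K \<longleftrightarrow> ?K \<subseteq> G" by auto
  then show ?thesis
    unfolding two_closed_def two_closure_greatest(4)[OF subgroup_Sym] by auto
qed

text \<open>Elements of \<open>induced \<Gamma> G\<close> are replaced by elements of
  \<open>G\<close>, which take the same values on \<Gamma>. Closedness on \<Omega> and on \<Gamma>
  can then be compared through the same group.\<close>

lemma two_closed_induced_iff:
  assumes "\<Gamma> \<subseteq> \<Omega>" "\<forall>h\<in>G. h ` \<Gamma> \<subseteq> \<Gamma>"
  shows "two_closed \<Gamma> (induced \<Gamma> G) \<longleftrightarrow>
     (\<forall>f\<in>Bij \<Gamma>. (\<forall>x\<in>\<Gamma>. \<forall>y\<in>\<Gamma>. \<exists>h\<in>G. f x = h x \<and> f y = h y) \<longrightarrow> (\<exists>g\<in>G. f = restrict g \<Gamma>))"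
proof -
  interpret I: permutation_group \<Gamma> "induced \<Gamma> G"
    using induced_subgroup[OF assms] by (rule permutation_group.intro)
  show ?thesis
    unfolding I.two_closed_iff by (auto simp: induced_def image_iff)
qed

end

section \<open>Removing an orbit from an abelian permutation group\<close>

locale commuting_permutation_group = permutation_group +
  assumes commute: "g \<in> G \<Longrightarrow> h \<in> G \<Longrightarrow> x \<in> \<Omega> \<Longrightarrow> g (h x) = h (g x)"
begin

text \<open>This is regularity on orbits: for \<open>y = k x\<close>, moving \<open>k\<close> to the
  front of \<open>g (k x)\<close> and \<open>h (k x)\<close> reduces the claim to
  \<open>g x = h x\<close>.\<close>

lemma eq_on_orbit:
  assumes "\<Delta> \<in> Orb \<Omega> G" "x \<in> \<Delta>" "y \<in> \<Delta>" "g \<in> G" "h \<in> G" "g x = h x"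
  shows "g y = h y"
proof -
  obtain k where "k \<in> G" "y = k x" using orbit_of_mem[OF assms(1,2)] assms(3) by auto
  moreover have "x \<in> \<Omega>" using assms orbit_subset by blast
  ultimately show ?thesis using commute assms by metis
qed

text \<open>One base point in each orbit selects \<open>h\<close>. At any further point of that
  orbit, \<open>f\<close> agrees with some \<open>k\<close> that also matches \<open>f\<close> at
  the base point, and regularity gives \<open>k = h\<close> on the whole orbit. The two orbits may
  coincide; \<Gamma> is later \<Omega> or the complement of an orbit.\<close>

lemma locally_eq_on_orbits:
  assumes "\<Delta> \<in> Orb \<Omega> G" "\<Delta>' \<in> Orb \<Omega> G" "\<Delta> \<subseteq> \<Gamma>" "\<Delta>' \<subseteq> \<Gamma>"
    and loc: "\<forall>x\<in>\<Gamma>. \<forall>y\<in>\<Gamma>. \<exists>h\<in>G. f x = h x \<and> f y = h y"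
  shows "\<exists>h\<in>G. \<forall>x\<in>\<Delta> \<union> \<Delta>'. f x = h x"
proof -
  obtain a b where ab: "a \<in> \<Delta>" "b \<in> \<Delta>'" using orbit_nonempty assms(1,2) by blast
  then obtain h where h: "h \<in> G" "f a = h a" "f b = h b" using loc assms(3,4) by blast
  have "f x = h x" if O: "\<Theta> \<in> Orb \<Omega> G" "\<Theta> \<subseteq> \<Gamma>" "c \<in> \<Theta>" "f c = h c" "x \<in> \<Theta>" for \<Theta> c x
  proof -
    obtain k where "k \<in> G" "f c = k c" "f x = k x" using loc O(2,3,5) by blast
    then show ?thesis using eq_on_orbit[OF O(1,3,5) _ h(1)] O(4) by metis
  qed
  from this[OF assms(1,3) ab(1) h(2)] this[OF assms(2,4) ab(2) h(3)]
  show ?thesis using h(1) by blast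
qed

lemma unessential_if_stabilizer_subset:
  assumes D: "\<Delta> \<in> Orb \<Omega> G" and D': "\<Delta>' \<in> Orb \<Omega> G" "\<Delta> \<noteq> \<Delta>'"
    and stab: "pointwise_stabilizer \<Delta>' G \<subseteq> pointwise_stabilizer \<Delta> G"
  shows "unessential \<Omega> G \<Delta>"
proof -
  let ?\<Gamma> = "\<Omega> - \<Delta>"
  have D'sub: "\<Delta>' \<subseteq> ?\<Gamma>" using orbit_disjoint[OF D D'] orbit_subset D' by blast
  have Dsub: "\<Delta> \<subseteq> \<Omega>" using orbit_subset D .
  have compl_inv: "\<forall>h\<in>G. h ` ?\<Gamma> \<subseteq> ?\<Gamma>"
    using orbit_mem_iff[OF D] in_range by auto
  \<comment> \<open>If \<open>g\<close> and \<open>h\<close> agree on \<Delta>', then the inverse of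
    \<open>h\<close> composed with \<open>g\<close> fixes \<Delta>' pointwise, hence by
    \<open>stab\<close> also \<Delta>.\<close>
  have determined: "g x = h x"
    if gh: "g \<in> G" "h \<in> G" and eq: "\<And>x. x \<in> \<Delta>' \<Longrightarrow> g x = h x" and x: "x \<in> \<Delta>" for g h x
  proof -
    obtain h' where h': "h' \<in> G" "\<And>x. x \<in> \<Omega> \<Longrightarrow> h' (h x) = x" "\<And>x. x \<in> \<Omega> \<Longrightarrow> h (h' x) = x"
      using inverse_closed[OF gh(2)] by metis
    have "compose \<Omega> h' g \<in> pointwise_stabilizer \<Delta>' G"
      using compose_closed[OF h'(1) gh(1)] eq h'(2) D'sub
      by (auto simp: pointwise_stabilizer_def compose_def)
    then have "compose \<Omega> h' g x = x" using stab x by (auto simp: pointwise_stabilizer_def)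
    then have "h' (g x) = x" using x Dsub by (auto simp: compose_def)
    then show ?thesis using h'(3)[of "g x"] in_range gh x Dsub by auto
  qed
  \<comment> \<open>Closedness passes to the complement: \<open>f\<close> is extended to \<Delta> by
    the element \<open>h\<close> that realizes it on \<Delta>', and the extension \<open>F\<close>
    is shown to lie in the 2-closure of \<open>G\<close>.\<close>
  have "\<exists>g\<in>G. f = restrict g ?\<Gamma>"
    if closed: "two_closed \<Omega> G" and fB: "f \<in> Bij ?\<Gamma>"
      and loc: "\<forall>x\<in>?\<Gamma>. \<forall>y\<in>?\<Gamma>. \<exists>h\<in>G. f x = h x \<and> f y = h y" for f
  proof -
    obtain h where h: "h \<in> G" "\<And>x. x \<in> \<Delta>' \<union> \<Delta>' \<Longrightarrow> f x = h x"
      using locally_eq_on_orbits[OF D'(1) D'(1) D'sub D'sub loc] by auto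
    define F where "F = (\<lambda>x\<in>\<Omega>. if x \<in> \<Delta> then h x else f x)"
    have F_simps: "\<And>x. x \<in> \<Delta> \<Longrightarrow> F x = h x" "\<And>x. x \<in> ?\<Gamma> \<Longrightarrow> F x = f x"
      using Dsub by (auto simp: F_def)
    have FB: "F \<in> Bij \<Omega>"
      unfolding F_def
      using glue_in_Bij[OF Dsub bij_betw_invariant[OF h(1) Dsub orbit_image_subset[OF D]]] fB
      by (simp add: Bij_def)
    \<comment> \<open>The element \<open>k\<close> realizing \<open>f\<close> on \<Theta> together
      with \<Delta>' equals \<open>h\<close> on \<Delta>', so by \<open>determined\<close> it equals
      \<open>h\<close>, and hence \<open>F\<close>, on \<Delta>.\<close>
    have mixed: "\<exists>k\<in>G. (\<forall>x\<in>\<Delta>. F x = k x) \<and> F y = k y" if y: "y \<in> ?\<Gamma>" for y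
    proof -
      obtain \<Theta> where O: "\<Theta> \<in> Orb \<Omega> G" "y \<in> \<Theta>" using orbit_exists y by blast
      have O\<Gamma>: "\<Theta> \<subseteq> ?\<Gamma>" using orbit_disjoint[OF D O(1)] orbit_subset[OF O(1)] O y by blast
      obtain k where k: "k \<in> G" "\<And>x. x \<in> \<Theta> \<union> \<Delta>' \<Longrightarrow> f x = k x"
        using locally_eq_on_orbits[OF O(1) D'(1) O\<Gamma> D'sub loc] by auto
      have "h x = k x" if "x \<in> \<Delta>" for x
        by (rule determined) (use h k that in auto)
      then show ?thesis using k O F_simps y by (intro bexI[of _ k]) auto
    qed
    have "\<exists>k\<in>G. F x = k x \<and> F y = k y" if "x \<in> \<Omega>" "y \<in> \<Omega>" for x y
    proof (cases "x \<in> \<Delta>"; cases "y \<in> \<Delta>")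
      assume "x \<in> \<Delta>" "y \<in> \<Delta>"
      then show ?thesis using h(1) F_simps(1) by blast
    next
      assume "x \<in> \<Delta>" "y \<notin> \<Delta>"
      then show ?thesis using mixed[of y] that by blast
    next
      assume "x \<notin> \<Delta>" "y \<in> \<Delta>"
      then show ?thesis using mixed[of x] that by blast
    next
      assume "x \<notin> \<Delta>" "y \<notin> \<Delta>"
      then show ?thesis using loc that F_simps(2) by simp
    qed
    then have "F \<in> G" using closed FB two_closed_iff by blast
    moreover have "f = restrict F ?\<Gamma>"
      using fB F_simps(2) by (auto simp: Bij_def extensional_def fun_eq_iff)
    ultimately show ?thesis by blast
  qed
  \<comment> \<open>Closedness passes back to \<Omega>: some \<open>g\<close> in \<open>G\<close>
    realizes \<open>f\<close> off \<Delta>, and some \<open>k\<close> realizes \<open>f\<close> on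
    \<Delta> and \<Delta>'. They agree on \<Delta>', hence on \<Delta>, so
    \<open>f = g\<close>.\<close>
  moreover have "f \<in> G"
    if closed: "\<forall>f\<in>Bij ?\<Gamma>. (\<forall>x\<in>?\<Gamma>. \<forall>y\<in>?\<Gamma>. \<exists>h\<in>G. f x = h x \<and> f y = h y) \<longrightarrow>
        (\<exists>g\<in>G. f = restrict g ?\<Gamma>)"
      and fB: "f \<in> Bij \<Omega>"
      and loc: "\<forall>x\<in>\<Omega>. \<forall>y\<in>\<Omega>. \<exists>h\<in>G. f x = h x \<and> f y = h y" for f
  proof -
    have D'\<Omega>: "\<Delta>' \<subseteq> \<Omega>" using D'sub by blast
    obtain k where k: "k \<in> G" "\<And>x. x \<in> \<Delta> \<union> \<Delta>' \<Longrightarrow> f x = k x"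
      using locally_eq_on_orbits[OF D D'(1) Dsub D'\<Omega> loc] by auto
    \<comment> \<open>Since \<open>f\<close> acts on \<Delta> as \<open>k\<close> does, it preserves
      \<Delta> and therefore its complement, so its restriction is a permutation there.\<close>
    have "bij_betw f \<Delta> \<Delta>"
      using iffD2[OF bij_betw_cong bij_betw_invariant[OF k(1) Dsub orbit_image_subset[OF D]]] k(2)
      by (meson UnI1)
    then have "bij_betw f ?\<Gamma> ?\<Gamma>"
      using fB Dsub bij_betw_DiffI[of f \<Omega> \<Omega> \<Delta> \<Delta>] by (auto simp: Bij_def)
    then have "restrict f ?\<Gamma> \<in> Bij ?\<Gamma>" by (simp add: Bij_def)
    moreover have "\<forall>x\<in>?\<Gamma>. \<forall>y\<in>?\<Gamma>. \<exists>h\<in>G. restrict f ?\<Gamma> x = h x \<and> restrict f ?\<Gamma> y = h y"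
      using loc by simp
    ultimately obtain g where g: "g \<in> G" "restrict f ?\<Gamma> = restrict g ?\<Gamma>" using closed by blast
    have off: "f x = g x" if "x \<in> ?\<Gamma>" for x using fun_cong[OF g(2), of x] that by simp
    have "k x = g x" if "x \<in> \<Delta>" for x
    proof (rule determined[OF k(1) g(1) _ that])
      show "k y = g y" if "y \<in> \<Delta>'" for y using that k(2)[of y] off[of y] D'sub by auto
    qed
    then have "f x = g x" if "x \<in> \<Omega>" for x using off k(2) that by (cases "x \<in> \<Delta>") auto
    then have "f = g"
      using fB in_Bij[OF g(1)] extensionalityI[of f \<Omega> g] by (auto simp: Bij_def)
    then show ?thesis using g(1) by simp
  qed
  ultimately show ?thesis
    unfolding unessential_def two_closed_induced_iff[OF Diff_subset compl_inv]
    using two_closed_iff by blast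
qed

end

section \<open>From the hypotheses on \<open>Zel\<close> and the constituents to the theorem\<close>

text \<open>If the stabilizer of every other orbit acted nontrivially on \<Delta>, the element
  common to all nontrivial subgroups of the constituent would lie in the whole intersection indexed
  by \<Delta>. Extended by the identity, it would be a nontrivial element of
  \<open>Zel \<Omega> G\<close>.\<close>

lemma (in permutation_group) stabilizer_subset_if_Zel_trivial:
  assumes cyc: "cyclic_group (perm_group \<Delta> (induced \<Delta> G))"
    and pgr: "finite_p_group p (perm_group \<Delta> (induced \<Delta> G))" and p: "prime p"
    and D: "\<Delta> \<in> Orb \<Omega> G" and two: "intransitive \<Omega> G"
    and Zel: "trivial_group (perm_group \<Omega> (Zel \<Omega> G))"
  obtains \<Delta>' where "\<Delta>' \<in> Orb \<Omega> G" "\<Delta> \<noteq> \<Delta>'"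
    "pointwise_stabilizer \<Delta>' G \<subseteq> pointwise_stabilizer \<Delta> G"
proof -
  let ?C = "perm_group \<Delta> (induced \<Delta> G)"
  have Dsub: "\<Delta> \<subseteq> \<Omega>" using orbit_subset D .
  have subC: "subgroup (induced \<Delta> G) (BijGroup \<Delta>)"
    using induced_subgroup[OF Dsub orbit_image_subset[OF D]] .
  interpret C: group ?C
    using subgroup.subgroup_is_group[OF subC group_BijGroup] .
  have one: "\<one>\<^bsub>?C\<^esub> = (\<lambda>x\<in>\<Delta>. x)" by (simp add: BijGroup_simps)
  have stabC: "subgroup (induced \<Delta> (pointwise_stabilizer \<Delta>' G)) ?C" if "\<Delta>' \<in> Orb \<Omega> G" for \<Delta>'
  proof -
    interpret S: permutation_group \<Omega> "pointwise_stabilizer \<Delta>' G"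
      using pointwise_stabilizer_subgroup[OF orbit_subset[OF that]] by (rule permutation_group.intro)
    have "subgroup (induced \<Delta> (pointwise_stabilizer \<Delta>' G)) (BijGroup \<Delta>)"
      by (rule S.induced_subgroup[OF Dsub]) (auto simp: pointwise_stabilizer_def orbit_mem[OF D])
    moreover have "induced \<Delta> (pointwise_stabilizer \<Delta>' G) \<subseteq> induced \<Delta> G"
      by (auto simp: induced_def pointwise_stabilizer_def)
    ultimately show ?thesis using group.subgroup_incl[OF group_BijGroup _ subC] by blast
  qed
  have "\<exists>\<Delta>'\<in>Orb \<Omega> G - {\<Delta>}. induced \<Delta> (pointwise_stabilizer \<Delta>' G) = {\<one>\<^bsub>?C\<^esub>}"
  proof (rule ccontr)
    assume non: "\<not> ?thesis"
    \<comment> \<open>A second orbit supplies a nontrivial subgroup of the constituent, so the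
      constituent is nontrivial and \<open>z\<close> exists.\<close>
    have "\<not> Orb \<Omega> G \<subseteq> {\<Delta>}"
      using two card_mono[of "{\<Delta>}" "Orb \<Omega> G"] by (auto simp: intransitive_def)
    then obtain \<Delta>0 where D0: "\<Delta>0 \<in> Orb \<Omega> G" "\<Delta>0 \<noteq> \<Delta>" by blast
    have "carrier ?C \<noteq> {\<one>\<^bsub>?C\<^esub>}"
      using non D0 subgroup.subset[OF stabC[OF D0(1)]] subgroup.one_closed[OF stabC[OF D0(1)]] by blast
    then obtain z where z: "z \<in> carrier ?C" "z \<noteq> \<one>\<^bsub>?C\<^esub>"
      and zH: "\<And>H. subgroup H ?C \<Longrightarrow> H \<noteq> {\<one>\<^bsub>?C\<^esub>} \<Longrightarrow> z \<in> H"
      using C.cyclic_p_group_minimal_subgroup[OF cyc pgr p] by metis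
    have zmem: "z \<in> induced \<Delta> (pointwise_stabilizer \<Delta>' G)" if "\<Delta>' \<in> Orb \<Omega> G - {\<Delta>}" for \<Delta>'
      using zH[OF stabC] non that by blast
    have zB: "z \<in> Bij \<Delta>" using z(1) subgroup.subset[OF subC] by (auto simp: BijGroup_simps)
    define f where "f = (\<lambda>x\<in>\<Omega>. if x \<in> \<Delta> then z x else x)"
    have f\<Delta>: "restrict f \<Delta> = z"
      using zB Dsub by (auto simp: f_def Bij_def extensional_def fun_eq_iff)
    have fB: "f \<in> Bij \<Omega>"
      unfolding f_def using zB by (intro glue_in_Bij[OF Dsub]) (auto simp: Bij_def bij_betw_def)
    \<comment> \<open>On \<Delta> this is \<open>zmem\<close>; on any other orbit \<open>f\<close>
      is the identity, which every stabilizer induces.\<close>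
    have "restrict f \<Theta> \<in> induced \<Theta> (pointwise_stabilizer \<Theta>' G)"
      if O: "\<Theta> \<in> Orb \<Omega> G" "\<Theta>' \<in> Orb \<Omega> G - {\<Theta>}" for \<Theta> \<Theta>'
    proof (cases "\<Theta> = \<Delta>")
      case True
      then show ?thesis using zmem O f\<Delta> by simp
    next
      case False
      then have "restrict f \<Theta> = restrict (\<lambda>x\<in>\<Omega>. x) \<Theta>"
        using orbit_disjoint[OF D O(1)] orbit_subset[OF O(1)] by (auto simp: f_def fun_eq_iff)
      moreover have "(\<lambda>x\<in>\<Omega>. x) \<in> pointwise_stabilizer \<Theta>' G"
        using id_closed orbit_subset[of \<Theta>'] O by (auto simp: pointwise_stabilizer_def)
      ultimately show ?thesis unfolding induced_def by (metis imageI)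
    qed
    then have "f \<in> Zel \<Omega> G" using fB by (auto simp: Zel_def BijGroup_simps)
    then have "f = (\<lambda>x\<in>\<Omega>. x)" using Zel by (auto simp: trivial_group_def BijGroup_simps)
    then have "z = \<one>\<^bsub>?C\<^esub>" unfolding one using f\<Delta>[symmetric] Dsub by (simp add: Int_absorb1)
    then show False using z(2) by simp
  qed
  then obtain \<Delta>' where D': "\<Delta>' \<in> Orb \<Omega> G" "\<Delta>' \<noteq> \<Delta>"
    and triv: "induced \<Delta> (pointwise_stabilizer \<Delta>' G) = {\<lambda>x\<in>\<Delta>. x}" unfolding one by blast
  have "pointwise_stabilizer \<Delta>' G \<subseteq> pointwise_stabilizer \<Delta> G"
  proof
    fix g assume g: "g \<in> pointwise_stabilizer \<Delta>' G"
    then have "restrict g \<Delta> = (\<lambda>x\<in>\<Delta>. x)" using triv by (auto simp: induced_def)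
    then have "g x = x" if "x \<in> \<Delta>" for x using that by (metis restrict_apply')
    then show "g \<in> pointwise_stabilizer \<Delta> G" using g by (simp add: pointwise_stabilizer_def)
  qed
  then show thesis using that D' by metis
qed

text \<open>Commuting can be tested at each point, hence inside the orbit containing it, where the
  constituent is cyclic and so abelian.\<close>

lemma (in permutation_group) commuting_if_cyclic_constituents:
  assumes cyc: "\<And>\<Delta>. \<Delta> \<in> Orb \<Omega> G \<Longrightarrow> cyclic_group (perm_group \<Delta> (induced \<Delta> G))"
  shows "commuting_permutation_group \<Omega> G"
proof unfold_locales
  fix g h x assume g: "g \<in> G" and h: "h \<in> G" and x: "x \<in> \<Omega>"
  obtain \<Delta> where D: "\<Delta> \<in> Orb \<Omega> G" "x \<in> \<Delta>" using orbit_exists[OF x] .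
  note rB = restrict_in_Bij[OF _ orbit_subset[OF D(1)] orbit_image_subset[OF D(1)]]
  have subC: "subgroup (induced \<Delta> G) (BijGroup \<Delta>)"
    using induced_subgroup[OF orbit_subset orbit_image_subset, OF D(1) D(1)] .
  interpret C: comm_group "perm_group \<Delta> (induced \<Delta> G)"
    using group.cyclic_imp_abelian_group[OF subgroup.subgroup_is_group[OF subC group_BijGroup] cyc[OF D(1)]] .
  have "compose \<Delta> (restrict g \<Delta>) (restrict h \<Delta>) = compose \<Delta> (restrict h \<Delta>) (restrict g \<Delta>)"
    using C.m_comm[of "restrict g \<Delta>" "restrict h \<Delta>"] rB[OF g] rB[OF h] g h
    by (auto simp: induced_def BijGroup_simps)
  then have "compose \<Delta> (restrict g \<Delta>) (restrict h \<Delta>) x = compose \<Delta> (restrict h \<Delta>) (restrict g \<Delta>) x"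
    by simp
  then show "g (h x) = h (g x)"
    using D g h orbit_mem[OF D(1)] by (simp add: compose_eq)
qed

theorem theorem1p4:
  fixes \<Omega> :: "'a set" and G :: "('a \<Rightarrow> 'a) set" and p :: nat
  assumes "finite \<Omega>"
    and "subgroup G (BijGroup \<Omega>)"
    and "intransitive \<Omega> G"
    and "prime p"
    and "\<And>\<Delta>. \<Delta> \<in> Orb \<Omega> G \<Longrightarrow>
           cyclic_group (perm_group \<Delta> (induced \<Delta> G)) \<and>
           finite_p_group p (perm_group \<Delta> (induced \<Delta> G))"
    and "trivial_group (perm_group \<Omega> (Zel \<Omega> G))"
  shows "\<forall>\<Delta>\<in>Orb \<Omega> G. unessential \<Omega> G \<Delta>"
proof
  fix \<Delta> assume D: "\<Delta> \<in> Orb \<Omega> G"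
  interpret permutation_group \<Omega> G using assms(2) by (rule permutation_group.intro)
  interpret commuting_permutation_group \<Omega> G
    by (rule commuting_if_cyclic_constituents) (rule conjunct1[OF assms(5)])
  obtain \<Delta>' where "\<Delta>' \<in> Orb \<Omega> G" "\<Delta> \<noteq> \<Delta>'"
    "pointwise_stabilizer \<Delta>' G \<subseteq> pointwise_stabilizer \<Delta> G"
    using stabilizer_subset_if_Zel_trivial[OF conjunct1[OF assms(5)[OF D]] conjunct2[OF assms(5)[OF D]]
        assms(4) D assms(3,6)] .
  then show "unessential \<Omega> G \<Delta>" by (rule unessential_if_stabilizer_subset[OF D])
qed

end
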